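(* Let $\omega$ be a non-degenerate skew-symmetric bilinear form on $\mathbb{R}^{2n}$, and let $\nabla,\nabla'$ be two affine structures on $\mathbb{R}^{2n}$, both compatible with $\omega$, satisfying $\nabla_x\nabla'_y=\nabla_y\nabla'_x$ for all $x,y\in\mathbb{R}^{2n}$. Let $N_{\nabla,\nabla'}$ be the associated nilpotent Lie group with Lie algebra $\mathfrak{n}_{\nabla,\nabla'}=\mathbb{R}^{2n}\oplus\mathbb{R}^{2n}$, and let $g$ be the left-invariant hypersymplectic metric on $N_{\nabla,\nabla'}$ determined on $\mathfrak{n}_{\nabla,\nabla'}$ by $g((x,x'),(y,y'))=-\omega(x,y')+\omega(x',y)$. Then $g$ is (geodesically) complete.
   Context: An affine structure on $\mathbb{R}^m$ is a bilinear map $\nabla:\mathbb{R}^m\times\mathbb{R}^m\to\mathbb{R}^m$, $(x,y)\mapsto\nabla_xy$, such that $\nabla_xy=\nabla_yx$ and $\nabla_x\nabla_y=\nabla_y\nabla_x$ (as endomorphisms of $\mathbb{R}^m$) for all $x,y\in\mathbb{R}^m$. It is compatible with a non-degenerate skew-symmetric bilinear form $\omega$ on $\mathbb{R}^m$ if $\omega(\nabla_xy,z)=\omega(\nabla_xz,y)$ for all $x,y,z\in\mathbb{R}^m$. Given $\omega,\nabla,\nabla'$ as in the claim, $N_{\nabla,\nabla'}$ is the manifold $\mathbb{R}^{4n}=\mathbb{R}^{2n}\times\mathbb{R}^{2n}$ with the product $$(x,x')\cdot(y,y')=\bigl(x+y+\nabla'_yx'-\tfrac12\nabla'_y\nabla_yx',\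 x'-\nabla_{x'}y-\tfrac12\nabla_{x'}\nabla'_{x'}y+y'\bigr).$$ It is a nilpotent Lie group with neutral element $(0,0)$, and its Lie algebra $\mathfrak{n}_{\nabla,\nabla'}$ is $\mathbb{R}^{2n}\oplus\mathbb{R}^{2n}$ with bracket $[(x,x'),(y,y')]=(\nabla'_yx'-\nabla'_xy',\ \nabla_xy'-\nabla_yx')$. The metric $g$ is pseudo-Riemannian of signature $(2n,2n)$; together with the left-invariant endomorphisms $J(x,x')=(-x',x)$ and $E(x,x')=(x,-x')$ it forms a hypersymplectic structure on $N_{\nabla,\nabla'}$, whence its name. Complete means that every geodesic of the Levi-Civita connection of $g$ is defined on all of $\mathbb{R}$. *)

theory Defs
  imports "HOL-Analysis.Analysis" "HOL-Algebra.Group"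
begin

definition nondegenerate :: "('v::real_vector \<Rightarrow> 'v \<Rightarrow> real) \<Rightarrow> bool" where
  "nondegenerate b \<longleftrightarrow>
     (\<forall>x. (\<forall>y. b x y = 0) \<longrightarrow> x = 0) \<and> (\<forall>y. (\<forall>x. b x y = 0) \<longrightarrow> y = 0)"

definition skew_symmetric :: "('v::real_vector \<Rightarrow> 'v \<Rightarrow> real) \<Rightarrow> bool" where
  "skew_symmetric b \<longleftrightarrow> (\<forall>x y. b x y = - b y x)"

definition affine_structure :: "('v::real_vector \<Rightarrow> 'v \<Rightarrow> 'v) \<Rightarrow> bool" where
  "affine_structure nab \<longleftrightarrow> bilinear nab \<and>
     (\<forall>x y. nab x y = nab y x) \<and> (\<forall>x y. nab x \<circ> nab y = nab y \<circ> nab x)"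

definition compatible ::
    "('v::real_vector \<Rightarrow> 'v \<Rightarrow> real) \<Rightarrow> ('v \<Rightarrow> 'v \<Rightarrow> 'v) \<Rightarrow> bool" where
  "compatible \<omega> nab \<longleftrightarrow> (\<forall>x y z. \<omega> (nab x y) z = \<omega> (nab x z) y)"

definition N_group ::
    "('v::real_vector \<Rightarrow> 'v \<Rightarrow> 'v) \<Rightarrow> ('v \<Rightarrow> 'v \<Rightarrow> 'v) \<Rightarrow> ('v \<times> 'v) monoid" where
  "N_group nab nab' =
     \<lparr>carrier = UNIV,
      monoid.mult = (\<lambda>(x, x') (y, y').
        (x + y + nab' y x' - (1/2) *\<^sub>R nab' y (nab y x'),
         x' - nab x' y - (1/2) *\<^sub>R nab x' (nab' x' y) + y')),
      one = (0, 0)\<rparr>"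

(* The Lie algebra is the tangent space at (0, 0), which is the vector space itself. *)
definition lie_algebra_metric ::
    "('v::real_vector \<Rightarrow> 'v \<Rightarrow> real) \<Rightarrow> 'v \<times> 'v \<Rightarrow> 'v \<times> 'v \<Rightarrow> real" where
  "lie_algebra_metric \<omega> = (\<lambda>(x, x') (y, y'). - \<omega> x y' + \<omega> x' y)"

(* A metric on the manifold 'a is a function g with g p u v the product of the tangent
   vectors u, v at p. Left translation by the inverse of p moves p to the identity. *)
definition left_invariant_metric ::
    "'a::real_normed_vector monoid \<Rightarrow> ('a \<Rightarrow> 'a \<Rightarrow> real) \<Rightarrow> 'a \<Rightarrow> 'a \<Rightarrow> 'a \<Rightarrow> real" where
  "left_invariant_metric G h p u v =
     (let D = frechet_derivative (\<lambda>q. inv\<^bsub>G\<^esub> p \<otimes>\<^bsub>G\<^esub> q) (at p) in h (D u) (D v))"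

(* Every connection on a vector space has the form
     (nabla_X Y)(p) = DY(p)(X p) + Gam p (X p) (Y p).
   It is torsion-free iff each Gam p is symmetric. The last conjunct is nabla g = 0:
   u (g(v, w)) = g(nabla_u v, w) + g(v, nabla_u w) for constant fields v, w. *)
definition levi_civita ::
    "('a::euclidean_space \<Rightarrow> 'a \<Rightarrow> 'a \<Rightarrow> real) \<Rightarrow> ('a \<Rightarrow> 'a \<Rightarrow> 'a \<Rightarrow> 'a) \<Rightarrow> bool" where
  "levi_civita g Gam \<longleftrightarrow>
     (\<forall>p. bilinear (Gam p)) \<and>
     (\<forall>p u v. Gam p u v = Gam p v u) \<and>
     (\<forall>p v w. ((\<lambda>q. g q v w) has_derivative
        (\<lambda>u. g p (Gam p u v) w + g p v (Gam p u w))) (at p))"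

lemma levi_civita_unique:
  assumes bil: "\<And>p. bilinear (g p)" and sym: "\<And>p u v. g p u v = g p v u"
    and nondeg: "\<And>p. nondegenerate (g p)"
    and "levi_civita g Gam" "levi_civita g Gam'"
  shows "Gam = Gam'"
proof (intro ext)
  fix p u v
  define D where "D u v = Gam p u v - Gam' p u v" for u v
  have s: "D u v = D v u" for u v
    using assms(4,5) by (simp add: levi_civita_def D_def)
  have a: "g p (D u v) w = - g p (D u w) v" for u v w
  proof -
    have "(\<lambda>u. g p (Gam p u v) w + g p v (Gam p u w)) =
          (\<lambda>u. g p (Gam' p u v) w + g p v (Gam' p u w))"
      using assms(4,5) unfolding levi_civita_def by (blast intro: has_derivative_unique)
    then have "g p (Gam p u v) w + g p v (Gam p u w) =
          g p (Gam' p u v) w + g p v (Gam' p u w)" by meson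
    then show ?thesis
      by (simp add: D_def bilinear_lsub[OF bil] sym[of p v])
  qed
  have "g p (D u v) w = 0" for w
    using a[of u v w] a[of w u v] a[of v w u] s[of u w] s[of v w] s[of u v] by simp
  then have "D u v = 0"
    using nondeg unfolding nondegenerate_def by blast
  then show "Gam p u v = Gam' p u v" by (simp add: D_def)
qed

definition geodesic_on ::
    "('a::euclidean_space \<Rightarrow> 'a \<Rightarrow> 'a \<Rightarrow> 'a) \<Rightarrow> real set \<Rightarrow> (real \<Rightarrow> 'a) \<Rightarrow> bool" where
  "geodesic_on Gam I c \<longleftrightarrow> (\<exists>c'. \<forall>t\<in>I.
     (c has_vector_derivative c' t) (at t) \<and>
     (c' has_vector_derivative - Gam (c t) (c' t) (c' t)) (at t))"

(* A metric without a Levi-Civita connection is not complete under this definition. *)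
definition geodesically_complete :: "('a::euclidean_space \<Rightarrow> 'a \<Rightarrow> 'a \<Rightarrow> real) \<Rightarrow> bool" where
  "geodesically_complete g \<longleftrightarrow> (\<exists>Gam. levi_civita g Gam \<and>
     (\<forall>I c. open I \<and> is_interval I \<and> I \<noteq> {} \<and> geodesic_on Gam I c \<longrightarrow>
        (\<exists>d. geodesic_on Gam UNIV d \<and> (\<forall>t\<in>I. d t = c t))))"

end

theory Submission
  imports Defs
begin

text \<open>
  Write \<open>A\<close> and \<open>B\<close> for the two affine structures \<open>\<nabla>\<close> and \<open>\<nabla>'\<close>. The idea is that they
  generate so little that every geodesic is a cubic polynomial in time.

  Compatibility says that each \<open>A\<^sub>x\<close> and \<open>B\<^sub>x\<close> is skew with respect to \<open>\<omega>\<close>. An affine structure is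
  a commutative associative product, and skewness then forces \<open>A\<^sub>x A\<^sub>y = 0\<close> and \<open>B\<^sub>x B\<^sub>y = 0\<close>
  (\<open>compatible_affine_nilpotent\<close>). The exchange condition makes \<open>\<omega> (A\<^sub>x B\<^sub>y z) w\<close> totally symmetric
  in its four arguments (\<open>quartic_sym\<close>), from which \<open>B\<^sub>x A\<^sub>y = - A\<^sub>x B\<^sub>y\<close> (\<open>BA_eq\<close>). Hence every
  product of three of the operators vanishes, and the only surviving double product is the
  symmetric trilinear map \<open>A\<^sub>x B\<^sub>y z\<close>, called \<open>triple x y z\<close>.

  With these relations, inverses in the group and differentials of left translations are short
  polynomial expressions, and so are the left-invariant metric (\<open>left_invariant_metric_eq\<close>) and its
  Christoffel symbols (\<open>levi_civita_christoffel\<close>). For a curve \<open>(Q, P)\<close> with velocity \<open>(v, w)\<close> the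
  geodesic equations are \<open>v' = - A\<^sub>v v + 4 A\<^sub>P B\<^sub>v v\<close> and \<open>w' = - B\<^sub>w w - 2 A\<^sub>w v + 4 A\<^sub>P B\<^sub>w v\<close>.
  Differentiating along a solution, almost all terms contain two \<open>A\<close>'s, two \<open>B\<close>'s or three operators
  in succession, hence vanish, which leaves
  \<open>v'' = 4 A\<^sub>w B\<^sub>v v\<close> and \<open>w'' = 2 A\<^sub>w B\<^sub>w v\<close>, whose right-hand sides are constant in time
  (\<open>geodesic_third_derivative\<close>). So a geodesic on an interval is the restriction of a cubic
  polynomial. This polynomial solves the geodesic equation for all times, because both sides of the
  equation are polynomials in time that agree on the interval (\<open>geodesic_extends\<close>).
\<close>

section \<open>Curves with vanishing fourth derivative and polynomial maps\<close>

lemma equal_derivatives_on_interval: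
  fixes f g :: "real \<Rightarrow> 'a::real_normed_vector"
  assumes I: "is_interval I"
    and f: "\<And>t. t \<in> I \<Longrightarrow> (f has_vector_derivative h t) (at t)"
    and g: "\<And>t. t \<in> I \<Longrightarrow> (g has_vector_derivative h t) (at t)"
  obtains k where "\<And>t. t \<in> I \<Longrightarrow> f t = k + g t"
proof -
  have "((\<lambda>t. f t - g t) has_vector_derivative 0) (at t within I)" if "t \<in> I" for t
    using has_vector_derivative_diff[OF f[OF that] g[OF that]]
    by (auto intro: has_vector_derivative_at_within)
  then obtain k where "\<And>t. t \<in> I \<Longrightarrow> f t - g t = k"
    using has_vector_derivative_zero_constant[OF is_interval_convex[OF I]] by blast
  then show ?thesis
    by (intro that[of k]) (simp add: diff_eq_eq)
qed

lemma cubic_if_fourth_derivative_0: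
  fixes c :: "real \<Rightarrow> 'a::real_normed_vector"
  assumes I: "is_interval I"
    and c: "\<And>t. t \<in> I \<Longrightarrow> (c has_vector_derivative c1 t) (at t)"
    and c1: "\<And>t. t \<in> I \<Longrightarrow> (c1 has_vector_derivative c2 t) (at t)"
    and c2: "\<And>t. t \<in> I \<Longrightarrow> (c2 has_vector_derivative c3 t) (at t)"
    and c3: "\<And>t. t \<in> I \<Longrightarrow> (c3 has_vector_derivative 0) (at t)"
  obtains a0 a1 a2 a3 where
    "\<And>t. t \<in> I \<Longrightarrow> c t = a0 + t *\<^sub>R a1 + (t\<^sup>2 / 2) *\<^sub>R a2 + (t ^ 3 / 6) *\<^sub>R a3"
    "\<And>t. t \<in> I \<Longrightarrow> c1 t = a1 + t *\<^sub>R a2 + (t\<^sup>2 / 2) *\<^sub>R a3"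
    "\<And>t. t \<in> I \<Longrightarrow> c2 t = a2 + t *\<^sub>R a3"
proof -
  obtain a3 where a3: "\<And>t. t \<in> I \<Longrightarrow> c3 t = a3"
    using equal_derivatives_on_interval[OF I c3, of "\<lambda>_. 0"] by auto
  have 1: "((\<lambda>t. t *\<^sub>R a) has_vector_derivative a) (at t)"
    and 2: "((\<lambda>t. (t\<^sup>2 / 2) *\<^sub>R a) has_vector_derivative t *\<^sub>R a) (at t)"
    and 3: "((\<lambda>t. (t ^ 3 / 6) *\<^sub>R a) has_vector_derivative (t\<^sup>2 / 2) *\<^sub>R a) (at t)"
    for a :: 'a and t :: real
    by (auto intro!: derivative_eq_intros)
  have "((\<lambda>t. t *\<^sub>R a3) has_vector_derivative c3 t) (at t)" if "t \<in> I" for t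
    using 1[of a3 t] by (simp add: a3 that)
  from equal_derivatives_on_interval[OF I c2 this]
  obtain a2 where a2: "\<And>t. t \<in> I \<Longrightarrow> c2 t = a2 + t *\<^sub>R a3" by blast
  have "((\<lambda>t. t *\<^sub>R a2 + (t\<^sup>2 / 2) *\<^sub>R a3) has_vector_derivative c2 t) (at t)" if "t \<in> I" for t
    using has_vector_derivative_add[OF 1 2] by (simp add: a2 that)
  from equal_derivatives_on_interval[OF I c1 this]
  obtain a1 where a1: "\<And>t. t \<in> I \<Longrightarrow> c1 t = a1 + (t *\<^sub>R a2 + (t\<^sup>2 / 2) *\<^sub>R a3)" by blast
  have "((\<lambda>t. t *\<^sub>R a1 + ((t\<^sup>2 / 2) *\<^sub>R a2 + (t ^ 3 / 6) *\<^sub>R a3)) has_vector_derivative c1 t) (at t)"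
    if "t \<in> I" for t
    using has_vector_derivative_add[OF 1 has_vector_derivative_add[OF 2 3]] by (simp add: a1 that)
  from equal_derivatives_on_interval[OF I c this]
  obtain a0 where "\<And>t. t \<in> I \<Longrightarrow> c t = a0 + (t *\<^sub>R a1 + ((t\<^sup>2 / 2) *\<^sub>R a2 + (t ^ 3 / 6) *\<^sub>R a3))"
    by blast
  with a1 a2 show ?thesis
    by (intro that[of a0 a1 a2 a3]) (simp_all add: add.assoc)
qed

lemma polynomial_function_bounded_bilinear:
  fixes f :: "'c::real_normed_vector \<Rightarrow> 'a::euclidean_space" and g :: "'c \<Rightarrow> 'b::euclidean_space"
  assumes h: "bounded_bilinear h" and f: "polynomial_function f" and g: "polynomial_function g"
  shows "polynomial_function (\<lambda>x. h (f x) (g x))"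
proof -
  interpret bounded_bilinear h by (rule h)
  have "h u v = (\<Sum>j\<in>Basis. \<Sum>i\<in>Basis. (v \<bullet> j) *\<^sub>R (u \<bullet> i) *\<^sub>R h i j)" for u v
  proof -
    have "h u v = h (\<Sum>i\<in>Basis. (u \<bullet> i) *\<^sub>R i) (\<Sum>j\<in>Basis. (v \<bullet> j) *\<^sub>R j)"
      by (simp only: euclidean_representation)
    then show ?thesis
      by (simp only: sum_left sum_right scaleR_left scaleR_right scaleR_sum_right)
  qed
  then have "(\<lambda>x. h (f x) (g x)) = (\<lambda>x. \<Sum>j\<in>Basis. \<Sum>i\<in>Basis. (g x \<bullet> j) *\<^sub>R (f x \<bullet> i) *\<^sub>R h i j)"
    by (rule ext)
  then show ?thesis
    by (simp only:) (intro polynomial_function_sum finite_Basis polynomial_function_mult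
        polynomial_function_inner polynomial_function_const f g)
qed

lemma polynomial_function_eq_0_if_infinite_zeros:
  fixes f :: "real \<Rightarrow> 'a::euclidean_space"
  assumes f: "polynomial_function f" and I: "infinite I" and 0: "\<And>t. t \<in> I \<Longrightarrow> f t = 0"
  shows "f t = 0"
proof (rule euclidean_eqI)
  fix i :: 'a
  assume "i \<in> Basis"
  then have "real_polynomial_function (\<lambda>x. f x \<bullet> i)"
    using f by (simp add: polynomial_function_iff_Basis_inner)
  then obtain a n where a: "(\<lambda>x. f x \<bullet> i) = (\<lambda>x. \<Sum>k\<le>n. a k * x ^ k)"
    unfolding real_polynomial_function_iff_sum by blast
  have "(\<Sum>k\<le>n. a k * s ^ k) = 0" if "s \<in> I" for s
    using fun_cong[OF a, of s] 0[OF that] by simp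
  then have "I \<subseteq> {x. (\<Sum>k\<le>n. a k * x ^ k) = 0}"
    by blast
  then have "\<forall>k\<le>n. a k = 0"
    using I finite_subset polyfun_finite_roots[of a n] by blast
  then show "f t \<bullet> i = 0 \<bullet> i"
    using fun_cong[OF a] by simp
qed

section \<open>The algebra of two compatible affine structures\<close>

text \<open>
  The endomorphism \<open>nab x \<circ> nab y\<close> equals \<open>nab (nab x y)\<close>, so it is skew for \<open>\<omega>\<close>; as a product of two
  commuting skew endomorphisms it is also self-adjoint.
\<close>
lemma compatible_affine_nilpotent:
  fixes \<omega> :: "'v::real_vector \<Rightarrow> 'v \<Rightarrow> real"
  assumes skew: "skew_symmetric \<omega>" and nd: "nondegenerate \<omega>"
    and aff: "affine_structure nab" and comp: "compatible \<omega> nab"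
  shows "nab x (nab y z) = 0"
proof -
  have sym: "nab x y = nab y x" for x y
    using aff by (simp add: affine_structure_def)
  have comm: "nab x (nab y z) = nab y (nab x z)" for x y z
    using aff unfolding affine_structure_def by (metis comp_apply)
  have sp: "\<omega> (nab x y) z = \<omega> (nab x z) y" for x y z
    using comp by (simp add: compatible_def)
  have sk: "\<omega> x y = - \<omega> y x" for x y
    using skew unfolding skew_symmetric_def by blast
  have assoc: "nab x (nab y z) = nab (nab x y) z" for x y z
    by (metis sym comm)
  have "\<omega> (nab x (nab y z)) w = 0" for w
  proof -
    have "\<omega> (nab x (nab y z)) w = \<omega> (nab x (nab y w)) z"
      by (metis assoc sp)
    also have "\<dots> = \<omega> (nab x z) (nab y w)"
      by (rule sp)
    also have "\<dots> = - \<omega> (nab y (nab x z)) w"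
      by (metis sk sp)
    also have "\<dots> = - \<omega> (nab x (nab y z)) w"
      by (simp add: comm)
    finally show ?thesis by simp
  qed
  then show ?thesis
    using nd unfolding nondegenerate_def by blast
qed

text \<open>The hypotheses on \<open>\<omega>\<close>, \<open>\<nabla>\<close> and \<open>\<nabla>'\<close> over a Euclidean space, with \<open>A\<close> in place of \<open>\<nabla>\<close> and \<open>B\<close> in place of \<open>\<nabla>'\<close>.\<close>
locale compatible_affine_pair =
  fixes \<omega> :: "'v::euclidean_space \<Rightarrow> 'v \<Rightarrow> real"
    and A B :: "'v \<Rightarrow> 'v \<Rightarrow> 'v"
  assumes bilinear_\<omega>: "bilinear \<omega>"
    and skew_\<omega>: "skew_symmetric \<omega>"
    and nondegenerate_\<omega>: "nondegenerate \<omega>"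
    and affine_A: "affine_structure A"
    and affine_B: "affine_structure B"
    and compatible_A: "compatible \<omega> A"
    and compatible_B: "compatible \<omega> B"
    and exchange: "\<forall>x y. A x \<circ> B y = A y \<circ> B x"
begin

lemma bilinear_A: "bilinear A" and bilinear_B: "bilinear B"
  using affine_A affine_B by (simp_all add: affine_structure_def)

sublocale \<omega>: bounded_bilinear \<omega>
  using bilinear_\<omega> by (simp add: bilinear_conv_bounded_bilinear)

sublocale A: bounded_bilinear A
  using bilinear_A by (simp add: bilinear_conv_bounded_bilinear)

sublocale B: bounded_bilinear B
  using bilinear_B by (simp add: bilinear_conv_bounded_bilinear)

lemma \<omega>_skew: "\<omega> x y = - \<omega> y x"
  using skew_\<omega> unfolding skew_symmetric_def by blast

lemma eq_0_if_\<omega>: "(\<And>w. \<omega> z w = 0) \<Longrightarrow> z = 0"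
  using nondegenerate_\<omega> unfolding nondegenerate_def by blast

lemma A_sym: "A x y = A y x" and B_sym: "B x y = B y x"
  using affine_A affine_B by (simp_all add: affine_structure_def)

lemma A_sp: "\<omega> (A x y) z = \<omega> (A x z) y" and B_sp: "\<omega> (B x y) z = \<omega> (B x z) y"
  using compatible_A compatible_B by (simp_all add: compatible_def)

lemma AA [simp]: "A x (A y z) = 0" "A (A y z) x = 0"
  using compatible_affine_nilpotent[OF skew_\<omega> nondegenerate_\<omega> affine_A compatible_A]
  by (simp_all add: A_sym[of "A y z"])

lemma BB [simp]: "B x (B y z) = 0" "B (B y z) x = 0"
  using compatible_affine_nilpotent[OF skew_\<omega> nondegenerate_\<omega> affine_B compatible_B]
  by (simp_all add: B_sym[of "B y z"])

lemma AB_swap: "A x (B y z) = A y (B x z)"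
  using exchange by (metis comp_apply)

text \<open>The quartic form \<open>\<omega> (A\<^sub>x B\<^sub>y z) w\<close> that detects the product \<open>A\<^sub>x B\<^sub>y\<close>.\<close>
definition quartic :: "'v \<Rightarrow> 'v \<Rightarrow> 'v \<Rightarrow> 'v \<Rightarrow> real" where
  "quartic x y z w = \<omega> (A x (B y z)) w"

lemma quartic_sym:
  "quartic x y z w = quartic y x z w"
  "quartic x y z w = quartic x z y w"
  "quartic x y z w = quartic x y w z"
proof -
  show s12: "quartic x y z w = quartic y x z w" for x y z w
    by (simp add: quartic_def AB_swap[of x])
  show s23: "quartic x y z w = quartic x z y w" for x y z w
    by (simp add: quartic_def B_sym[of y])
  have s14: "quartic x y z w = quartic w y z x" for x y z w
    unfolding quartic_def by (metis A_sp A_sym)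
  show "quartic x y z w = quartic x y w z"
    by (metis s12 s23 s14)
qed

text \<open>
  Moving both operators across \<open>\<omega>\<close> reverses their order, and the total symmetry of the quartic form
  absorbs this up to one sign.
\<close>
lemma BA_eq: "B x (A y z) = - A x (B y z)"
proof -
  have "\<omega> (B x (A y z) + A x (B y z)) w = 0" for w
  proof -
    have "\<omega> (B x (A y z)) w = - \<omega> (A y z) (B x w)"
      by (metis B_sp \<omega>_skew)
    also have "\<dots> = - quartic y x w z"
      by (simp add: quartic_def A_sp[of y z])
    also have "\<dots> = - quartic x y z w"
      by (metis quartic_sym)
    finally show ?thesis
      by (simp add: \<omega>.add_left quartic_def)
  qed
  from eq_0_if_\<omega>[OF this] show ?thesis
    by (simp add: eq_neg_iff_add_eq_0)
qed

text \<open>Up to sign, the only product of two operators that can be nonzero. It is a totally symmetric trilinear map.\<close>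
definition triple :: "'v \<Rightarrow> 'v \<Rightarrow> 'v \<Rightarrow> 'v" where
  "triple x y z = A x (B y z)"

lemma triple_sym: "triple x y z = triple y x z" "triple x y z = triple x z y"
  unfolding triple_def by (rule AB_swap, metis B_sym)

lemma AB_triple: "A x (B y z) = triple x y z" "A (B y z) x = triple x y z"
  by (simp_all add: triple_def A_sym[of "B y z"])

lemma BA_triple: "B x (A y z) = - triple x y z" "B (A y z) x = - triple x y z"
  by (simp_all add: triple_def BA_eq B_sym[of "A y z"])

lemma triple_annihilates:
  "A u (triple x y z) = 0" "A (triple x y z) u = 0"
  "B u (triple x y z) = 0" "B (triple x y z) u = 0"
proof -
  show A: "A u (triple x y z) = 0"
    by (simp add: triple_def)
  have "B u (- B x (A y z)) = 0"
    unfolding B.minus_right by simp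
  then show B: "B u (triple x y z) = 0"
    by (simp add: BA_triple)
  show "A (triple x y z) u = 0" "B (triple x y z) u = 0"
    using A B by (simp_all add: A_sym[of _ u] B_sym[of _ u])
qed

text \<open>
  The rules below bring every expression in \<open>A\<close>, \<open>B\<close> and \<open>\<omega>\<close> to a normal form: first expand by
  multilinearity and evaluate nested products (\<open>multilinear\<close>, \<open>\<omega>_linear\<close>, \<open>products\<close>,
  \<open>forms_of_products\<close>), then sort the arguments of the symmetric maps that remain.
\<close>
lemmas AB_linear = A.add_left A.add_right A.diff_left A.diff_right A.minus_left A.minus_right
  A.scaleR_left A.scaleR_right A.zero_left A.zero_right
  B.add_left B.add_right B.diff_left B.diff_right B.minus_left B.minus_right
  B.scaleR_left B.scaleR_right B.zero_left B.zero_right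

lemma triple_linear:
  "triple (x + x') y z = triple x y z + triple x' y z"
  "triple (x - x') y z = triple x y z - triple x' y z"
  "triple (- x) y z = - triple x y z" "triple (c *\<^sub>R x) y z = c *\<^sub>R triple x y z"
  "triple 0 y z = 0"
  "triple x (y + y') z = triple x y z + triple x y' z"
  "triple x (y - y') z = triple x y z - triple x y' z"
  "triple x (- y) z = - triple x y z" "triple x (c *\<^sub>R y) z = c *\<^sub>R triple x y z"
  "triple x 0 z = 0"
  "triple x y (z + z') = triple x y z + triple x y z'"
  "triple x y (z - z') = triple x y z - triple x y z'"
  "triple x y (- z) = - triple x y z" "triple x y (c *\<^sub>R z) = c *\<^sub>R triple x y z"
  "triple x y 0 = 0"
  by (simp_all add: triple_def AB_linear)

lemmas multilinear = AB_linear triple_linear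

lemma triple_of_products:
  "triple (A u v) y z = 0" "triple y (A u v) z = 0" "triple y z (A u v) = 0"
  "triple (B u v) y z = 0" "triple y (B u v) z = 0" "triple y z (B u v) = 0"
  "triple (triple u v w) y z = 0" "triple y (triple u v w) z = 0" "triple y z (triple u v w) = 0"
proof -
  show A: "triple (A u v) y z = 0" and B: "triple y z (B u v) = 0"
    by (simp_all add: triple_def A.zero_right)
  show "triple y (A u v) z = 0" "triple y z (A u v) = 0"
    using A triple_sym by metis+
  show "triple y (B u v) z = 0" "triple (B u v) y z = 0"
    using B triple_sym by metis+
  show T: "triple (triple u v w) y z = 0"
    unfolding triple_def[of "triple u v w"] by (rule triple_annihilates)
  then show "triple y (triple u v w) z = 0" "triple y z (triple u v w) = 0"
    using triple_sym by metis+
qed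

lemmas products = AB_triple BA_triple triple_annihilates triple_of_products
lemmas product_order = A_sym B_sym triple_sym

text \<open>The cubic forms \<open>\<omega> (A\<^sub>x y) z\<close> and \<open>\<omega> (B\<^sub>x y) z\<close>, totally symmetric by commutativity and compatibility.\<close>
definition cubicA :: "'v \<Rightarrow> 'v \<Rightarrow> 'v \<Rightarrow> real" where
  "cubicA x y z = \<omega> (A x y) z"

definition cubicB :: "'v \<Rightarrow> 'v \<Rightarrow> 'v \<Rightarrow> real" where
  "cubicB x y z = \<omega> (B x y) z"

lemma cubicA_sym: "cubicA x y z = cubicA y x z" "cubicA x y z = cubicA x z y"
  unfolding cubicA_def by (metis A_sym, rule A_sp)

lemma cubicB_sym: "cubicB x y z = cubicB y x z" "cubicB x y z = cubicB x z y"
  unfolding cubicB_def by (metis B_sym, rule B_sp)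

lemma \<omega>_forms:
  "\<omega> (A x y) z = cubicA x y z" "\<omega> z (A x y) = - cubicA x y z"
  "\<omega> (B x y) z = cubicB x y z" "\<omega> z (B x y) = - cubicB x y z"
  "\<omega> (triple x y z) w = quartic x y z w" "\<omega> w (triple x y z) = - quartic x y z w"
  by (simp_all add: cubicA_def cubicB_def quartic_def triple_def \<omega>_skew[of z] \<omega>_skew[of w])

lemma forms_of_products:
  "\<omega> (A x y) (A u v) = 0" "\<omega> (A x y) (B u v) = quartic x y u v"
  "\<omega> (B u v) (A x y) = - quartic x y u v" "\<omega> (B x y) (B u v) = 0"
  "\<omega> (A x y) (triple u v z) = 0" "\<omega> (B x y) (triple u v z) = 0"
  "\<omega> (triple u v z) (A x y) = 0" "\<omega> (triple u v z) (B x y) = 0"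
  "\<omega> (triple u v z) (triple x y w) = 0"
proof -
  have A: "\<omega> (A x y) p = \<omega> (A x p) y" and B: "\<omega> (B x y) p = \<omega> (B x p) y" for x y p
    by (rule A_sp B_sp)+
  show AA: "\<omega> (A x y) (A u v) = 0" and BB: "\<omega> (B x y) (B u v) = 0"
    and AT: "\<omega> (A x y) (triple u v z) = 0" and BT: "\<omega> (B x y) (triple u v z) = 0"
    unfolding A[of x y] B[of x y] by (simp_all add: triple_annihilates \<omega>.zero_left)
  show AB: "\<omega> (A x y) (B u v) = quartic x y u v"
    unfolding A[of x y] using quartic_sym by (metis quartic_def)
  show "\<omega> (B u v) (A x y) = - quartic x y u v"
    unfolding \<omega>_skew[of "B u v"] AB ..
  show "\<omega> (triple u v z) (A x y) = 0" "\<omega> (triple u v z) (B x y) = 0"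
    unfolding \<omega>_skew[of "triple u v z"] by (simp_all add: AT BT)
  show "\<omega> (triple u v z) (triple x y w) = 0"
    unfolding triple_def[of x] \<omega>_skew[of "triple u v z"] A_sp[of x "B y w"]
    by (simp add: triple_annihilates \<omega>.zero_left)
qed

lemmas \<omega>_linear = \<omega>.add_left \<omega>.add_right \<omega>.diff_left \<omega>.diff_right \<omega>.minus_left \<omega>.minus_right
  \<omega>.scaleR_left \<omega>.scaleR_right \<omega>.zero_left \<omega>.zero_right

section \<open>The group and its left-invariant metric\<close>

lemma inverse_N_group:
  "inv\<^bsub>N_group A B\<^esub> (x, x') =
     (- x + B x' x - (1/2) *\<^sub>R triple x' x x, - x' - A x' x + (1/2) *\<^sub>R triple x' x' x)"
    (is "_ = (?a, ?a')")
proof -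
  have R: "(x, x') \<otimes>\<^bsub>N_group A B\<^esub> (?a, ?a') = (0, 0)"
    apply (simp add: N_group_def multilinear products)
    apply (simp add: product_order algebra_simps flip: scaleR_add_left)
    done
  have L: "(?a, ?a') \<otimes>\<^bsub>N_group A B\<^esub> (x, x') = (0, 0)"
    apply (simp add: N_group_def multilinear products)
    apply (simp add: product_order algebra_simps flip: scaleR_add_left)
    done
  have half: "z - (1/2) *\<^sub>R z = (1/2) *\<^sub>R z" for z :: 'v
    by (simp add: algebra_simps flip: scaleR_add_left)
  \<comment> \<open>A right inverse is determined by the first component of the equation: \<open>y + x\<close> is a sum of
    products, so the nonlinear terms in \<open>y\<close> can be evaluated at \<open>- x\<close>.\<close>
  have unique: "y = ?a \<and> y' = ?a'"
    if "(x, x') \<otimes>\<^bsub>N_group A B\<^esub> (y, y') = (0, 0)" for y y'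
  proof -
    have y: "y = - x - B y x' - (1/2) *\<^sub>R triple y y x'"
      and y': "y' = - x' + A x' y + (1/2) *\<^sub>R triple x' x' y"
      using that by (simp_all add: N_group_def products algebra_simps eq_neg_iff_add_eq_0)
    have B: "B v y = - B v x" for v
      by (subst y) (simp add: multilinear products)
    have "B y y = B x x"
      by (metis B B_sym minus_minus)
    then have "triple y y x' = triple x x x'"
      by (metis triple_def triple_sym)
    moreover have "B y x' = - B x' x"
      by (metis B B_sym)
    ultimately have "y = ?a"
      by (subst y) (simp add: triple_sym)
    moreover from this y' have "y' = ?a'"
      by (simp add: multilinear products half)
    ultimately show ?thesis ..
  qed
  have one: "\<one>\<^bsub>N_group A B\<^esub> = (0, 0)" and car: "carrier (N_group A B) = UNIV"
    by (simp_all add: N_group_def)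
  show ?thesis
    unfolding m_inv_def one car
  proof (rule the_equality)
    show "z = (?a, ?a')" if "z \<in> UNIV \<and> (x, x') \<otimes>\<^bsub>N_group A B\<^esub> z = (0, 0) \<and>
        z \<otimes>\<^bsub>N_group A B\<^esub> (x, x') = (0, 0)" for z
      using that unique by (metis surj_pair)
  qed (use L R in blast)
qed

lemma left_translation_derivative:
  "((\<lambda>q. (a, a') \<otimes>\<^bsub>N_group A B\<^esub> q) has_derivative
     (\<lambda>u. (fst u + B (fst u) a' + triple (fst p) (fst u) a',
           snd u - A a' (fst u) - (1/2) *\<^sub>R triple a' a' (fst u)))) (at p)"
proof -
  have F: "(fst has_derivative fst) (at p)" and S: "(snd has_derivative snd) (at p)"
    by (rule has_derivative_fst[OF has_derivative_ident] has_derivative_snd[OF has_derivative_ident])+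
  note const = has_derivative_const and add = has_derivative_add and diff = has_derivative_diff
    and scale = has_derivative_scaleR_right
  have 1: "((\<lambda>q. a + fst q + B (fst q) a' - (1/2) *\<^sub>R B (fst q) (A (fst q) a')) has_derivative
      (\<lambda>u. fst u + B (fst u) a' + triple (fst p) (fst u) a')) (at p)"
    apply (rule has_derivative_eq_rhs[OF diff[OF add[OF add[OF const F] B.FDERIV[OF F const]]
          scale[OF B.FDERIV[OF F A.FDERIV[OF F const]]]]])
    apply (simp add: fun_eq_iff multilinear products)
    apply (simp add: product_order algebra_simps flip: scaleR_add_left)
    done
  have 2: "((\<lambda>q. a' - A a' (fst q) - (1/2) *\<^sub>R A a' (B a' (fst q)) + snd q) has_derivative
      (\<lambda>u. snd u - A a' (fst u) - (1/2) *\<^sub>R triple a' a' (fst u))) (at p)"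
    apply (rule has_derivative_eq_rhs[OF add[OF diff[OF diff[OF const A.FDERIV[OF const F]]
          scale[OF A.FDERIV[OF const B.FDERIV[OF const F]]]] S]])
    apply (simp add: fun_eq_iff multilinear products)
    done
  show ?thesis
    using has_derivative_Pair[OF 1 2] by (simp add: N_group_def split_beta')
qed

text \<open>
  The differential at \<open>p\<close> of left translation by the inverse of \<open>p\<close>. It depends on the second
  component of \<open>p\<close> only, and therefore so does the metric.
\<close>
lemma translation_to_identity:
  "frechet_derivative (\<lambda>q. inv\<^bsub>N_group A B\<^esub> p \<otimes>\<^bsub>N_group A B\<^esub> q) (at p) =
     (\<lambda>u. (fst u - B (snd p) (fst u),
           snd u + A (snd p) (fst u) - (1/2) *\<^sub>R triple (snd p) (snd p) (fst u)))"
proof -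
  obtain x x' where p: "p = (x, x')" by (cases p)
  let ?a' = "- x' - A x' x + (1/2) *\<^sub>R triple x' x' x"
  have "frechet_derivative (\<lambda>q. inv\<^bsub>N_group A B\<^esub> p \<otimes>\<^bsub>N_group A B\<^esub> q) (at p) =
    (\<lambda>u. (fst u + B (fst u) ?a' + triple x (fst u) ?a',
          snd u - A ?a' (fst u) - (1/2) *\<^sub>R triple ?a' ?a' (fst u)))"
    unfolding p inverse_N_group
    by (rule frechet_derivative_at[symmetric])
      (use left_translation_derivative[of _ ?a' "(x, x')"] in \<open>simp only: fst_conv\<close>)
  also have "\<dots> = (\<lambda>u. (fst u - B (snd p) (fst u),
           snd u + A (snd p) (fst u) - (1/2) *\<^sub>R triple (snd p) (snd p) (fst u)))"
    apply (rule ext)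
    apply (simp add: p multilinear products)
    apply (simp add: product_order)
    done
  finally show ?thesis .
qed

text \<open>The left-invariant metric in the linear coordinates of the group.\<close>
definition metric :: "'v \<times> 'v \<Rightarrow> 'v \<times> 'v \<Rightarrow> 'v \<times> 'v \<Rightarrow> real" where
  "metric p u v = \<omega> (snd u) (fst v) - \<omega> (fst u) (snd v)
     + \<omega> (B (snd p) (fst u)) (snd v) + \<omega> (B (snd p) (fst v)) (snd u)
     + 2 * \<omega> (A (snd p) (fst u)) (fst v) - 3 * \<omega> (A (snd p) (B (snd p) (fst u))) (fst v)"

lemma left_invariant_metric_eq:
  "left_invariant_metric (N_group A B) (lie_algebra_metric \<omega>) = metric"
  apply (intro ext)
  apply (simp add: left_invariant_metric_def translation_to_identity lie_algebra_metric_def metric_def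
      multilinear products \<omega>_linear forms_of_products)
  apply (simp add: \<omega>_forms cubicA_sym cubicB_sym quartic_sym)
  done

section \<open>The Levi-Civita connection\<close>

text \<open>
  The Christoffel symbols of the metric. Their diagonal is read off from the Euler-Lagrange equations
  of the energy \<open>\<omega> w v + \<omega> (B\<^sub>P v) w + \<omega> (A\<^sub>P v) v - 3/2 * \<omega> (A\<^sub>P B\<^sub>P v) v\<close> of a velocity \<open>(v, w)\<close> at a point
  with second component \<open>P\<close>; polarization gives the rest.
\<close>
definition christoffel :: "'v \<times> 'v \<Rightarrow> 'v \<times> 'v \<Rightarrow> 'v \<times> 'v \<Rightarrow> 'v \<times> 'v" where
  "christoffel p u v =
     (A (fst u) (fst v) - 4 *\<^sub>R triple (snd p) (fst u) (fst v),
      B (snd u) (snd v) + A (snd u) (fst v) + A (snd v) (fst u)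
        - 2 *\<^sub>R triple (snd p) (snd u) (fst v) - 2 *\<^sub>R triple (snd p) (snd v) (fst u))"

lemma levi_civita_christoffel: "levi_civita metric christoffel"
  unfolding levi_civita_def
proof (intro conjI allI)
  fix p u v w
  show "bilinear (christoffel p)"
    by (simp add: bilinear_def linear_iff christoffel_def multilinear triple_def algebra_simps)
  show "christoffel p u v = christoffel p v u"
    by (simp add: christoffel_def product_order)
  have D: "(snd has_derivative snd) (at p)"
    by (rule has_derivative_snd[OF has_derivative_ident])
  have dA: "((\<lambda>q. \<omega> (A (snd q) x) y) has_derivative (\<lambda>u. \<omega> (A (snd u) x) y)) (at p)" for x y
    using \<omega>.FDERIV[OF A.FDERIV[OF D has_derivative_const] has_derivative_const]
    by (simp add: AB_linear \<omega>_linear)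
  have dB: "((\<lambda>q. \<omega> (B (snd q) x) y) has_derivative (\<lambda>u. \<omega> (B (snd u) x) y)) (at p)" for x y
    using \<omega>.FDERIV[OF B.FDERIV[OF D has_derivative_const] has_derivative_const]
    by (simp add: AB_linear \<omega>_linear)
  have dAB: "((\<lambda>q. \<omega> (A (snd q) (B (snd q) x)) y) has_derivative
      (\<lambda>u. \<omega> (triple (snd p) (snd u) x) y + \<omega> (triple (snd u) (snd p) x) y)) (at p)" for x y
    using \<omega>.FDERIV[OF A.FDERIV[OF D B.FDERIV[OF D has_derivative_const]] has_derivative_const]
    by (simp add: AB_linear \<omega>_linear AB_triple)
  have "((\<lambda>q. metric q v w) has_derivative
     (\<lambda>u. 0 - 0 + \<omega> (B (snd u) (fst v)) (snd w) + \<omega> (B (snd u) (fst w)) (snd v)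
     + 2 * \<omega> (A (snd u) (fst v)) (fst w)
     - 3 * (\<omega> (triple (snd p) (snd u) (fst v)) (fst w) + \<omega> (triple (snd u) (snd p) (fst v)) (fst w)))) (at p)"
    unfolding metric_def
    by (intro has_derivative_add has_derivative_diff has_derivative_mult_right has_derivative_const
        dA dB dAB)
  then show "((\<lambda>q. metric q v w) has_derivative
        (\<lambda>u. metric p (christoffel p u v) w + metric p v (christoffel p u w))) (at p)"
    apply (rule has_derivative_eq_rhs)
    apply (rule ext)
    apply (simp add: metric_def multilinear \<omega>_linear christoffel_def products forms_of_products)
    apply (simp add: \<omega>_forms cubicA_sym cubicB_sym quartic_sym)
    done
qed

section \<open>Geodesics\<close>

text \<open>
  The first two claims differentiate the accelerations of the two components of a geodesic along the
  geodesic equations; the last two say that the resulting third derivatives of the velocity vanish.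
\<close>
lemma geodesic_derivatives:
  assumes P: "(P has_vector_derivative w t) (at t)"
    and v: "(v has_vector_derivative - A (v t) (v t) + 4 *\<^sub>R triple (P t) (v t) (v t)) (at t)"
    and w: "(w has_vector_derivative - B (w t) (w t) - 2 *\<^sub>R A (w t) (v t)
              + 4 *\<^sub>R triple (P t) (w t) (v t)) (at t)"
  shows "((\<lambda>s. - A (v s) (v s) + 4 *\<^sub>R triple (P s) (v s) (v s)) has_vector_derivative
            4 *\<^sub>R triple (w t) (v t) (v t)) (at t)"
    and "((\<lambda>s. - B (w s) (w s) - 2 *\<^sub>R A (w s) (v s) + 4 *\<^sub>R triple (P s) (w s) (v s))
            has_vector_derivative 2 *\<^sub>R triple (w t) (w t) (v t)) (at t)"
    and "((\<lambda>s. triple (w s) (v s) (v s)) has_vector_derivative 0) (at t)"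
    and "((\<lambda>s. triple (w s) (w s) (v s)) has_vector_derivative 0) (at t)"
proof -
  note dA = A.has_vector_derivative and dB = B.has_vector_derivative
  have dT: "((\<lambda>s. triple (f s) (g s) (h s)) has_vector_derivative
      triple f' (g t) (h t) + triple (f t) g' (h t) + triple (f t) (g t) h') (at t)"
    if "(f has_vector_derivative f') (at t)" "(g has_vector_derivative g') (at t)"
      "(h has_vector_derivative h') (at t)" for f g h f' g' h'
    using dA[OF that(1) dB[OF that(2,3)]] by (simp add: AB_linear triple_def algebra_simps)
  note scale = bounded_linear.has_vector_derivative[OF bounded_linear_scaleR_right]
  note dAvv = dA[OF v v] and dAwv = dA[OF w v] and dBww = dB[OF w w]
    and dPvv = dT[OF P v v] and dPwv = dT[OF P w v]
  show "((\<lambda>s. - A (v s) (v s) + 4 *\<^sub>R triple (P s) (v s) (v s)) has_vector_derivative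
            4 *\<^sub>R triple (w t) (v t) (v t)) (at t)"
    using has_vector_derivative_add[OF has_vector_derivative_minus[OF dAvv] scale[OF dPvv, of 4]]
    by (simp add: multilinear products)
  show "((\<lambda>s. - B (w s) (w s) - 2 *\<^sub>R A (w s) (v s) + 4 *\<^sub>R triple (P s) (w s) (v s))
            has_vector_derivative 2 *\<^sub>R triple (w t) (w t) (v t)) (at t)"
    apply (rule has_vector_derivative_eq_rhs[OF has_vector_derivative_add[OF has_vector_derivative_diff[OF
        has_vector_derivative_minus[OF dBww] scale[OF dAwv, of 2]] scale[OF dPwv, of 4]]])
    apply (simp add: multilinear products)
    apply (simp add: product_order algebra_simps flip: scaleR_add_left)
    done
  show "((\<lambda>s. triple (w s) (v s) (v s)) has_vector_derivative 0) (at t)"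
    using dT[OF w v v] by (simp add: multilinear products)
  show "((\<lambda>s. triple (w s) (w s) (v s)) has_vector_derivative 0) (at t)"
    using dT[OF w w v] by (simp add: multilinear products)
qed

lemma geodesic_third_derivative:
  assumes c: "(c has_vector_derivative c' t) (at t)"
    and c': "(c' has_vector_derivative - christoffel (c t) (c' t) (c' t)) (at t)"
  defines "J \<equiv> \<lambda>s. (4 *\<^sub>R triple (snd (c' s)) (fst (c' s)) (fst (c' s)),
                   2 *\<^sub>R triple (snd (c' s)) (snd (c' s)) (fst (c' s)))"
  shows "((\<lambda>s. - christoffel (c s) (c' s) (c' s)) has_vector_derivative J t) (at t)"
    and "(J has_vector_derivative 0) (at t)"
proof -
  have double: "2 *\<^sub>R z = z + z" "4 *\<^sub>R z = z + z + z + z" for z :: 'v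
    using scaleR_2[of z] scaleR_left_distrib[of 2 2 z] by (simp_all add: add.assoc)
  have eq: "- christoffel (c s) (c' s) (c' s) =
    (- A (fst (c' s)) (fst (c' s)) + 4 *\<^sub>R triple (snd (c s)) (fst (c' s)) (fst (c' s)),
     - B (snd (c' s)) (snd (c' s)) - 2 *\<^sub>R A (snd (c' s)) (fst (c' s))
       + 4 *\<^sub>R triple (snd (c s)) (snd (c' s)) (fst (c' s)))" for s
    using double[of "A (snd (c' s)) (fst (c' s))"] double[of "triple (snd (c s)) (snd (c' s)) (fst (c' s))"]
    by (simp add: christoffel_def product_order algebra_simps)
  note fst_deriv = bounded_linear.has_vector_derivative[OF bounded_linear_fst]
    and snd_deriv = bounded_linear.has_vector_derivative[OF bounded_linear_snd]
  note d = geodesic_derivatives[of "\<lambda>s. snd (c s)" "\<lambda>s. snd (c' s)" t "\<lambda>s. fst (c' s)",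
      OF snd_deriv[OF c] fst_deriv[OF c', unfolded eq fst_conv] snd_deriv[OF c', unfolded eq snd_conv]]
  show "((\<lambda>s. - christoffel (c s) (c' s) (c' s)) has_vector_derivative J t) (at t)"
    unfolding eq J_def by (rule has_vector_derivative_Pair[OF d(1,2)])
  note scale = bounded_linear.has_vector_derivative[OF bounded_linear_scaleR_right]
  show "(J has_vector_derivative 0) (at t)"
    unfolding J_def
    using has_vector_derivative_Pair[OF scale[OF d(3), of 4] scale[OF d(4), of 2]]
    by (simp add: zero_prod_def)
qed

lemma geodesic_extends:
  assumes I: "open I" "is_interval I" "I \<noteq> {}" and geodesic: "geodesic_on christoffel I c"
  shows "\<exists>d. geodesic_on christoffel UNIV d \<and> (\<forall>t\<in>I. d t = c t)"
proof -
  obtain c' where c: "\<And>t. t \<in> I \<Longrightarrow> (c has_vector_derivative c' t) (at t)"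
    and c': "\<And>t. t \<in> I \<Longrightarrow> (c' has_vector_derivative - christoffel (c t) (c' t) (c' t)) (at t)"
    using geodesic unfolding geodesic_on_def by blast
  note third = geodesic_third_derivative[OF c c']
  obtain a0 a1 a2 a3 where
    eq: "\<And>t. t \<in> I \<Longrightarrow> c t = a0 + t *\<^sub>R a1 + (t\<^sup>2 / 2) *\<^sub>R a2 + (t ^ 3 / 6) *\<^sub>R a3"
    "\<And>t. t \<in> I \<Longrightarrow> c' t = a1 + t *\<^sub>R a2 + (t\<^sup>2 / 2) *\<^sub>R a3"
    "\<And>t. t \<in> I \<Longrightarrow> - christoffel (c t) (c' t) (c' t) = a2 + t *\<^sub>R a3"
    using cubic_if_fourth_derivative_0[OF I(2) c c' third] by blast
  define d where "d t = a0 + t *\<^sub>R a1 + (t\<^sup>2 / 2) *\<^sub>R a2 + (t ^ 3 / 6) *\<^sub>R a3" for t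
  define d' where "d' t = a1 + t *\<^sub>R a2 + (t\<^sup>2 / 2) *\<^sub>R a3" for t
  \<comment> \<open>The defect of \<open>d\<close> in the geodesic equation\<close>
  define e where "e t = a2 + t *\<^sub>R a3 + christoffel (d t) (d' t) (d' t)" for t
  have e_I: "e t = 0" if "t \<in> I" for t
    using eq[OF that] by (simp add: e_def d_def d'_def eq_neg_iff_add_eq_0 flip: eq(3)[OF that])
  have poly_power: "polynomial_function (\<lambda>t::real. t ^ k / r)" for k r
    unfolding real_polynomial_function_eq[symmetric]
    by (intro real_polynomial_function_divide real_polynomial_function_power)
      (simp add: real_polynomial_function_eq)
  have poly: "polynomial_function d" "polynomial_function d'"
    unfolding d_def d'_def
    by (intro polynomial_function_add polynomial_function_mult poly_power polynomial_function_id
        polynomial_function_const)+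
  have poly_fst: "polynomial_function (\<lambda>t. fst (f t))" and poly_snd: "polynomial_function (\<lambda>t. snd (f t))"
    if "polynomial_function f" for f :: "real \<Rightarrow> 'v \<times> 'v"
    using polynomial_function_compose[OF that polynomial_function_bounded_linear[OF bounded_linear_fst]]
      polynomial_function_compose[OF that polynomial_function_bounded_linear[OF bounded_linear_snd]]
    by (simp_all only: o_def)
  note poly_intros = polynomial_function_add polynomial_function_diff polynomial_function_mult
    polynomial_function_const polynomial_function_id
    polynomial_function_bounded_bilinear[OF A.bounded_bilinear_axioms]
    polynomial_function_bounded_bilinear[OF B.bounded_bilinear_axioms]
    poly_fst poly_snd poly
  have poly_e: "polynomial_function (\<lambda>t. fst (e t))" "polynomial_function (\<lambda>t. snd (e t))"
    unfolding e_def christoffel_def triple_def fst_add snd_add fst_conv snd_conv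
    by (intro poly_intros)+
  from I obtain t0 where "t0 \<in> interior I"
    by (auto simp: interior_open)
  then have "infinite I"
    using interior_limit_point islimpt_finite by blast
  then have "fst (e t) = 0" "snd (e t) = 0" for t
    using polynomial_function_eq_0_if_infinite_zeros[OF poly_e(1)]
      polynomial_function_eq_0_if_infinite_zeros[OF poly_e(2)] e_I
    by (metis fst_zero, metis snd_zero)
  then have "e t = 0" for t
    by (simp add: prod_eq_iff)
  then have d'': "- christoffel (d t) (d' t) (d' t) = a2 + t *\<^sub>R a3" for t
    unfolding e_def neg_eq_iff_add_eq_0 by (simp only: add_ac)
  have "(d has_vector_derivative d' t) (at t)" "(d' has_vector_derivative a2 + t *\<^sub>R a3) (at t)" for t
    unfolding d_def d'_def by (auto intro!: derivative_eq_intros)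
  then have "geodesic_on christoffel UNIV d"
    unfolding geodesic_on_def d''[symmetric] by blast
  then show ?thesis
    using eq(1) by (intro exI[of _ d]) (simp add: d_def)
qed

end

theorem theorem4p3:
  fixes n :: nat
    and \<omega> :: "real ^ 'm \<Rightarrow> real ^ 'm \<Rightarrow> real"
    and nab nab' :: "real ^ 'm \<Rightarrow> real ^ 'm \<Rightarrow> real ^ 'm"
  assumes "CARD('m) = 2 * n"
    and "bilinear \<omega>" and "skew_symmetric \<omega>" and "nondegenerate \<omega>"
    and "affine_structure nab" and "affine_structure nab'"
    and "compatible \<omega> nab" and "compatible \<omega> nab'"
    and "\<forall>x y. nab x \<circ> nab' y = nab y \<circ> nab' x"
  shows "geodesically_complete
           (left_invariant_metric (N_group nab nab') (lie_algebra_metric \<omega>))"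
proof -
  interpret compatible_affine_pair \<omega> nab nab'
    using assms by unfold_locales
  show ?thesis
    unfolding left_invariant_metric_eq geodesically_complete_def
  proof (intro exI[of _ christoffel] conjI allI impI)
    show "levi_civita metric christoffel"
      by (rule levi_civita_christoffel)
    fix I c
    assume "open I \<and> is_interval I \<and> I \<noteq> {} \<and> geodesic_on christoffel I c"
    then show "\<exists>d. geodesic_on christoffel UNIV d \<and> (\<forall>t\<in>I. d t = c t)"
      by (elim conjE) (rule geodesic_extends)
  qed
qed

end
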